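(* Let $\Lambda$ be a $k$-graph. For each $a\in\ker\partial_1\subseteq C_1(\Lambda)$ there exist simple closed trails $h_1,\dots,h_n$ in $C_1(\Lambda)$ and integers $m_1,\dots,m_n$ such that $a=\sum_{i=1}^n m_ih_i$ (the sum being allowed to be empty, $n=0$, when $a=0$).
   Context: Conventions: $0\in\mathbb{N}$ and $\mathbb{N}^0=\{0\}$. A $k$-graph ($k\ge0$) is a nonempty countable small category $\Lambda$ with a functor $d:\Lambda\to\mathbb{N}^k$ (the degree) satisfying the factorisation property: whenever $d(\lambda)=m+n$ there are unique $\mu,\nu\in\Lambda$ with $d(\mu)=m$, $d(\nu)=n$, $\lambda=\mu\nu$. Objects are identified with identity morphisms; $\Lambda^n=d^{-1}(n)$, so $\Lambda^0$ is the set of vertices; $r,s:\Lambda\to\Lambda^0$ are the codomain and domain maps. $e_1,\dots,e_k$ are the standard generators of $\mathbb{N}^k$. An edge is a morphism $f$ with $d(f)=e_i$ for some $i$. $C_0(\Lambda)=\mathbb{Z}\Lambda^0$ and $C_1(\Lambda)$ are the free abelian groups on the vertices and on the edges of $\Lambda$ respectively, and $\partial_1:C_1(\Lambda)\to C_0(\Lambda)$ is the homomorphism with $\partial_1(f)=s(f)-r(f)$ for each edge $f$. For an edge $f$ and $m\in\{1,-1\}$ put $s(f,1)=s(f)$, $s(f,-1)=r(f)$ and $r(f,m)=s(f,-m)$. An undirected path is a pair $(g,m)$ where $g=(g_1,\dots,g_n)$ is a sequence of edges and $m=(m_1,\dots,m_n)$ with $m_i\in\{1,-1\}$ such that $s(g_i,m_i)=r(g_{i+1},m_{i+1})$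 for all $i<n$; set $s(g,m)=s(g_n,m_n)$, $r(g,m)=r(g_1,m_1)$. It is closed if $r(g,m)=s(g,m)$; a closed undirected path is simple if $s(g_i,m_i)\ne s(g_j,m_j)$ for $i\neq j$. The trail associated to $(g,m)$ is $h=\sum_{i=1}^n m_ig_i\in C_1(\Lambda)$; it is a simple closed trail if $(g,m)$ is closed and simple. *)

theory Defs
  imports "HOL-Algebra.Free_Abelian_Groups"
begin

section \<open>Higher-rank graphs\<close>

text \<open>
  The monoid of \<open>k\<close>-tuples of naturals, for a natural number \<open>k\<close> that may be \<open>0\<close>, is the set of
  finitely supported functions with support in \<open>{1..k}\<close>, with pointwise addition.
\<close>

definition nat_tuples :: "nat \<Rightarrow> (nat \<Rightarrow>\<^sub>0 nat) set" where
  "nat_tuples k = {n. Poly_Mapping.keys n \<subseteq> {1..k}}"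

definition unit_tuple :: "nat \<Rightarrow> (nat \<Rightarrow>\<^sub>0 nat)" where
  "unit_tuple i = Poly_Mapping.single i 1"

text \<open>
  Objects are identified with their identity morphisms, so the codomain map \<open>rng\<close> and the domain
  map \<open>src\<close> send morphisms to morphisms. The composite \<open>cmp \<Lambda> \<mu> \<nu>\<close> of \<open>\<mu>\<close> after \<open>\<nu>\<close> is only
  meaningful when \<open>src \<Lambda> \<mu> = rng \<Lambda> \<nu>\<close>.
\<close>

record 'a graded_category =
  mor :: "'a set"
  rng :: "'a \<Rightarrow> 'a"
  src :: "'a \<Rightarrow> 'a"
  cmp :: "'a \<Rightarrow> 'a \<Rightarrow> 'a"
  deg :: "'a \<Rightarrow> (nat \<Rightarrow>\<^sub>0 nat)"

locale small_category =
  fixes \<Lambda> :: "'a graded_category"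
  assumes rng_closed: "\<xi> \<in> mor \<Lambda> \<Longrightarrow> rng \<Lambda> \<xi> \<in> mor \<Lambda>"
    and src_closed: "\<xi> \<in> mor \<Lambda> \<Longrightarrow> src \<Lambda> \<xi> \<in> mor \<Lambda>"
    and rng_rng: "\<xi> \<in> mor \<Lambda> \<Longrightarrow> rng \<Lambda> (rng \<Lambda> \<xi>) = rng \<Lambda> \<xi>"
    and src_rng: "\<xi> \<in> mor \<Lambda> \<Longrightarrow> src \<Lambda> (rng \<Lambda> \<xi>) = rng \<Lambda> \<xi>"
    and rng_src: "\<xi> \<in> mor \<Lambda> \<Longrightarrow> rng \<Lambda> (src \<Lambda> \<xi>) = src \<Lambda> \<xi>"
    and src_src: "\<xi> \<in> mor \<Lambda> \<Longrightarrow> src \<Lambda> (src \<Lambda> \<xi>) = src \<Lambda> \<xi>"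
    and cmp_closed: "\<lbrakk>\<mu> \<in> mor \<Lambda>; \<nu> \<in> mor \<Lambda>; src \<Lambda> \<mu> = rng \<Lambda> \<nu>\<rbrakk> \<Longrightarrow> cmp \<Lambda> \<mu> \<nu> \<in> mor \<Lambda>"
    and rng_cmp: "\<lbrakk>\<mu> \<in> mor \<Lambda>; \<nu> \<in> mor \<Lambda>; src \<Lambda> \<mu> = rng \<Lambda> \<nu>\<rbrakk>
                    \<Longrightarrow> rng \<Lambda> (cmp \<Lambda> \<mu> \<nu>) = rng \<Lambda> \<mu>"
    and src_cmp: "\<lbrakk>\<mu> \<in> mor \<Lambda>; \<nu> \<in> mor \<Lambda>; src \<Lambda> \<mu> = rng \<Lambda> \<nu>\<rbrakk>
                    \<Longrightarrow> src \<Lambda> (cmp \<Lambda> \<mu> \<nu>) = src \<Lambda> \<nu>"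
    and cmp_rng: "\<xi> \<in> mor \<Lambda> \<Longrightarrow> cmp \<Lambda> (rng \<Lambda> \<xi>) \<xi> = \<xi>"
    and cmp_src: "\<xi> \<in> mor \<Lambda> \<Longrightarrow> cmp \<Lambda> \<xi> (src \<Lambda> \<xi>) = \<xi>"
    and cmp_assoc: "\<lbrakk>\<xi> \<in> mor \<Lambda>; \<mu> \<in> mor \<Lambda>; \<nu> \<in> mor \<Lambda>; src \<Lambda> \<xi> = rng \<Lambda> \<mu>; src \<Lambda> \<mu> = rng \<Lambda> \<nu>\<rbrakk>
                    \<Longrightarrow> cmp \<Lambda> (cmp \<Lambda> \<xi> \<mu>) \<nu> = cmp \<Lambda> \<xi> (cmp \<Lambda> \<mu> \<nu>)"

locale k_graph = small_category \<Lambda>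
  for k :: nat and \<Lambda> :: "'a graded_category" +
  assumes nonempty: "mor \<Lambda> \<noteq> {}"
    and countable: "countable (mor \<Lambda>)"
    and deg_closed: "\<xi> \<in> mor \<Lambda> \<Longrightarrow> deg \<Lambda> \<xi> \<in> nat_tuples k"
    and deg_identity: "\<xi> \<in> mor \<Lambda> \<Longrightarrow> deg \<Lambda> (src \<Lambda> \<xi>) = 0" "\<xi> \<in> mor \<Lambda> \<Longrightarrow> deg \<Lambda> (rng \<Lambda> \<xi>) = 0"
    and deg_cmp: "\<lbrakk>\<mu> \<in> mor \<Lambda>; \<nu> \<in> mor \<Lambda>; src \<Lambda> \<mu> = rng \<Lambda> \<nu>\<rbrakk>
                    \<Longrightarrow> deg \<Lambda> (cmp \<Lambda> \<mu> \<nu>) = deg \<Lambda> \<mu> + deg \<Lambda> \<nu>"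
    and factorisation:
      "\<lbrakk>\<xi> \<in> mor \<Lambda>; m \<in> nat_tuples k; n \<in> nat_tuples k; deg \<Lambda> \<xi> = m + n\<rbrakk>
         \<Longrightarrow> \<exists>!p. case p of (\<mu>, \<nu>) \<Rightarrow> \<mu> \<in> mor \<Lambda> \<and> \<nu> \<in> mor \<Lambda> \<and> src \<Lambda> \<mu> = rng \<Lambda> \<nu> \<and>
                  deg \<Lambda> \<mu> = m \<and> deg \<Lambda> \<nu> = n \<and> \<xi> = cmp \<Lambda> \<mu> \<nu>"

definition morphisms_of_degree :: "'a graded_category \<Rightarrow> (nat \<Rightarrow>\<^sub>0 nat) \<Rightarrow> 'a set" where
  "morphisms_of_degree \<Lambda> n = {\<xi> \<in> mor \<Lambda>. deg \<Lambda> \<xi> = n}"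

definition vertices :: "'a graded_category \<Rightarrow> 'a set" where
  "vertices \<Lambda> = morphisms_of_degree \<Lambda> 0"

definition edges :: "nat \<Rightarrow> 'a graded_category \<Rightarrow> 'a set" where
  "edges k \<Lambda> = (\<Union>i\<in>{1..k}. morphisms_of_degree \<Lambda> (unit_tuple i))"

lemma (in k_graph) vertices_eq_identities: "vertices \<Lambda> = src \<Lambda> ` mor \<Lambda>"
proof
  show "src \<Lambda> ` mor \<Lambda> \<subseteq> vertices \<Lambda>"
    by (auto simp: vertices_def morphisms_of_degree_def src_closed deg_identity)
  show "vertices \<Lambda> \<subseteq> src \<Lambda> ` mor \<Lambda>"
  proof
    fix v assume "v \<in> vertices \<Lambda>"
    then have v: "v \<in> mor \<Lambda>" and d: "deg \<Lambda> v = 0"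
      by (auto simp: vertices_def morphisms_of_degree_def)
    have z: "(0 :: nat \<Rightarrow>\<^sub>0 nat) \<in> nat_tuples k"
      by (simp add: nat_tuples_def)
    let ?P = "\<lambda>p. case p of (\<mu>, \<nu>) \<Rightarrow> \<mu> \<in> mor \<Lambda> \<and> \<nu> \<in> mor \<Lambda> \<and> src \<Lambda> \<mu> = rng \<Lambda> \<nu> \<and>
                  deg \<Lambda> \<mu> = 0 \<and> deg \<Lambda> \<nu> = 0 \<and> v = cmp \<Lambda> \<mu> \<nu>"
    have "\<exists>!p. ?P p"
      using factorisation[OF v z z] d by simp
    moreover have "?P (v, src \<Lambda> v)" "?P (rng \<Lambda> v, v)"
      using v d by (simp_all add: src_closed rng_closed rng_src src_rng deg_identity cmp_src cmp_rng)
    ultimately have "(v, src \<Lambda> v) = (rng \<Lambda> v, v)"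
      by blast
    then show "v \<in> src \<Lambda> ` mor \<Lambda>"
      using v by (metis image_eqI prod.inject)
  qed
qed


section \<open>Chains and trails\<close>

definition C0 :: "'a graded_category \<Rightarrow> ('a \<Rightarrow>\<^sub>0 int) monoid" where
  "C0 \<Lambda> = free_Abelian_group (vertices \<Lambda>)"

definition C1 :: "nat \<Rightarrow> 'a graded_category \<Rightarrow> ('a \<Rightarrow>\<^sub>0 int) monoid" where
  "C1 k \<Lambda> = free_Abelian_group (edges k \<Lambda>)"

definition boundary1 :: "'a graded_category \<Rightarrow> ('a \<Rightarrow>\<^sub>0 int) \<Rightarrow> ('a \<Rightarrow>\<^sub>0 int)" where
  "boundary1 \<Lambda> = frag_extend (\<lambda>f. frag_of (src \<Lambda> f) - frag_of (rng \<Lambda> f))"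

text \<open>
  An undirected path \<open>((g\<^sub>1, \<dots>, g\<^sub>n), (m\<^sub>1, \<dots>, m\<^sub>n))\<close> is represented by the nonempty list of the
  pairs \<open>(g\<^sub>i, m\<^sub>i)\<close>; it is nonempty because its range and source refer to \<open>g\<^sub>1\<close> and \<open>g\<^sub>n\<close>.
\<close>

definition signed_src :: "'a graded_category \<Rightarrow> 'a \<times> int \<Rightarrow> 'a" where
  "signed_src \<Lambda> = (\<lambda>(f, m). if m = 1 then src \<Lambda> f else rng \<Lambda> f)"

definition signed_rng :: "'a graded_category \<Rightarrow> 'a \<times> int \<Rightarrow> 'a" where
  "signed_rng \<Lambda> = (\<lambda>(f, m). signed_src \<Lambda> (f, - m))"

definition undirected_path :: "nat \<Rightarrow> 'a graded_category \<Rightarrow> ('a \<times> int) list \<Rightarrow> bool" where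
  "undirected_path k \<Lambda> p \<longleftrightarrow>
     p \<noteq> [] \<and> set p \<subseteq> edges k \<Lambda> \<times> {1, -1} \<and>
     (\<forall>i. Suc i < length p \<longrightarrow> signed_src \<Lambda> (p ! i) = signed_rng \<Lambda> (p ! Suc i))"

definition path_src :: "'a graded_category \<Rightarrow> ('a \<times> int) list \<Rightarrow> 'a" where
  "path_src \<Lambda> p = signed_src \<Lambda> (last p)"

definition path_rng :: "'a graded_category \<Rightarrow> ('a \<times> int) list \<Rightarrow> 'a" where
  "path_rng \<Lambda> p = signed_rng \<Lambda> (hd p)"

definition closed_path :: "nat \<Rightarrow> 'a graded_category \<Rightarrow> ('a \<times> int) list \<Rightarrow> bool" where
  "closed_path k \<Lambda> p \<longleftrightarrow> undirected_path k \<Lambda> p \<and> path_rng \<Lambda> p = path_src \<Lambda> p"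

definition simple_closed_path :: "nat \<Rightarrow> 'a graded_category \<Rightarrow> ('a \<times> int) list \<Rightarrow> bool" where
  "simple_closed_path k \<Lambda> p \<longleftrightarrow> closed_path k \<Lambda> p \<and> distinct (map (signed_src \<Lambda>) p)"

definition trail :: "('a \<times> int) list \<Rightarrow> ('a \<Rightarrow>\<^sub>0 int)" where
  "trail p = (\<Sum>(f, m)\<leftarrow>p. frag_cmul m (frag_of f))"

definition simple_closed_trail :: "nat \<Rightarrow> 'a graded_category \<Rightarrow> ('a \<Rightarrow>\<^sub>0 int) \<Rightarrow> bool" where
  "simple_closed_trail k \<Lambda> h \<longleftrightarrow> (\<exists>p. simple_closed_path k \<Lambda> p \<and> h = trail p)"

end

theory Submission
  imports Defs
begin

text \<open>
  A chain \<open>a\<close> in the kernel of \<open>\<partial>\<^sub>1\<close> is an integral circulation. Orient every edge in its support by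
  the sign of its coefficient: then \<open>a\<close> becomes a positive circulation, so Kirchhoff's law at a
  vertex that is entered by an oriented edge forces some oriented edge to leave it
  (\<open>positive_edge_continues\<close>); here an oriented edge leads from its range to its source, in
  agreement with the order of the edges in an undirected path. Walking along oriented edges
  inside the finite support must revisit a vertex, and the first revisit closes up a simple closed path
  (\<open>successors_give_simple_closed_path\<close>). An edge is traversed in one direction only, so its
  coefficient in the trail \<open>h\<close> of this path is \<open>\<plusminus>1\<close> and no cancellation occurs.

  Subtracting a suitable integer multiple of \<open>h\<close> from \<open>a\<close> therefore kills the coefficient of one
  chosen edge of the path. The difference is again a cycle, its support lies inside that of \<open>a\<close>
  and has lost an edge, and the theorem follows by induction on the size of the support.
\<close>

lemma lookup_boundary1:
  "Poly_Mapping.lookup (boundary1 \<Lambda> a) v =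
     (\<Sum>f\<in>Poly_Mapping.keys a. Poly_Mapping.lookup a f *
        (of_bool (src \<Lambda> f = v) - of_bool (rng \<Lambda> f = v)))"
  unfolding boundary1_def frag_extend_def
  by (auto simp: lookup_sum lookup_minus when_def intro!: sum.cong)

text \<open>
  Reversing an edge changes the sign of its boundary. So after orienting an edge by the sign of its
  coefficient, the coefficient may be replaced by its absolute value.
\<close>

lemma lookup_boundary1_oriented:
  "Poly_Mapping.lookup (boundary1 \<Lambda> a) v =
     (\<Sum>f\<in>Poly_Mapping.keys a. \<bar>Poly_Mapping.lookup a f\<bar> *
        (of_bool (signed_src \<Lambda> (f, sgn (Poly_Mapping.lookup a f)) = v) -
         of_bool (signed_rng \<Lambda> (f, sgn (Poly_Mapping.lookup a f)) = v)))"
  unfolding lookup_boundary1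
  by (rule sum.cong) (auto simp: signed_src_def signed_rng_def sgn_if in_keys_iff)

definition positive_edges :: "('a \<Rightarrow>\<^sub>0 int) \<Rightarrow> ('a \<times> int) set" where
  "positive_edges a = (\<lambda>f. (f, sgn (Poly_Mapping.lookup a f))) ` Poly_Mapping.keys a"

lemma positive_edge_continues:
  assumes "boundary1 \<Lambda> a = 0" and "e \<in> positive_edges a"
  shows "\<exists>e'\<in>positive_edges a. signed_src \<Lambda> e = signed_rng \<Lambda> e'"
proof (rule ccontr)
  assume no_exit: "\<not> ?thesis"
  define flow where
    "flow f = \<bar>Poly_Mapping.lookup a f\<bar> *
       (of_bool (signed_src \<Lambda> (f, sgn (Poly_Mapping.lookup a f)) = signed_src \<Lambda> e) -
        of_bool (signed_rng \<Lambda> (f, sgn (Poly_Mapping.lookup a f)) = signed_src \<Lambda> e))" for f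
  obtain f where f: "f \<in> Poly_Mapping.keys a" "e = (f, sgn (Poly_Mapping.lookup a f))"
    using assms(2) by (auto simp: positive_edges_def)
  have no_exit': "signed_rng \<Lambda> (g, sgn (Poly_Mapping.lookup a g)) \<noteq> signed_src \<Lambda> e"
    if "g \<in> Poly_Mapping.keys a" for g
    using no_exit that unfolding positive_edges_def by fastforce
  have "0 < flow f"
    using f no_exit'[OF f(1)] by (simp add: flow_def in_keys_iff)
  also have "flow f \<le> sum flow (Poly_Mapping.keys a)"
    using f(1) no_exit' by (intro member_le_sum) (auto simp: flow_def)
  also have "\<dots> = Poly_Mapping.lookup (boundary1 \<Lambda> a) (signed_src \<Lambda> e)"
    unfolding lookup_boundary1_oriented flow_def ..
  finally show False
    using assms(1) by simp
qed

text \<open>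
  The least \<open>j\<close> at which a walk \<open>e\<^sub>0, e\<^sub>1, \<dots>\<close> revisits a vertex, say the source of \<open>e\<^sub>i\<close>, cuts out the
  simple closed path \<open>e\<^bsub>i+1\<^esub>, \<dots>, e\<^sub>j\<close>.
\<close>

lemma successors_give_simple_closed_path:
  assumes "finite E" "E \<noteq> {}" "E \<subseteq> edges k \<Lambda> \<times> {1, -1}"
    and continues: "\<And>e. e \<in> E \<Longrightarrow> \<exists>e'\<in>E. signed_src \<Lambda> e = signed_rng \<Lambda> e'"
  shows "\<exists>p. simple_closed_path k \<Lambda> p \<and> set p \<subseteq> E"
proof -
  obtain e where e: "\<And>n. e n \<in> E" "\<And>n. signed_src \<Lambda> (e n) = signed_rng \<Lambda> (e (Suc n))"
    using dependent_nat_choice[of "\<lambda>_ x. x \<in> E" "\<lambda>_ x y. signed_src \<Lambda> x = signed_rng \<Lambda> y"]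
      assms(2) continues by (metis ex_in_conv)
  define revisit where "revisit j \<longleftrightarrow> (\<exists>i<j. signed_src \<Lambda> (e i) = signed_src \<Lambda> (e j))" for j
  have "finite (range (\<lambda>n. signed_src \<Lambda> (e n)))"
    by (rule finite_subset[of _ "signed_src \<Lambda> ` E"]) (use e(1) assms(1) in auto)
  then have "\<not> inj (\<lambda>n. signed_src \<Lambda> (e n))"
    using finite_imageD infinite_UNIV_nat by blast
  then have "\<exists>j. revisit j"
    unfolding revisit_def inj_def by (metis linorder_neqE_nat)
  then obtain j where j: "revisit j" and min: "\<And>j'. j' < j \<Longrightarrow> \<not> revisit j'"
    by (metis exists_least_iff)
  then obtain i where i: "i < j" "signed_src \<Lambda> (e i) = signed_src \<Lambda> (e j)"
    unfolding revisit_def by blast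
  define p where "p = map e [Suc i..<Suc j]"
  have ends: "p \<noteq> []" "hd p = e (Suc i)" "last p = e j"
    using i(1) by (simp_all add: p_def hd_map last_map hd_upt last_upt del: upt_Suc)
  have walk: "set p \<subseteq> E"
    using e(1) by (auto simp: p_def)
  have "undirected_path k \<Lambda> p"
    unfolding undirected_path_def
    using ends(1) walk assms(3) e(2) by (auto simp: p_def simp del: upt_Suc set_map set_upt)
  moreover have "path_rng \<Lambda> p = path_src \<Lambda> p"
    unfolding path_rng_def path_src_def ends using e(2)[of i] i(2) by simp
  moreover have "signed_src \<Lambda> (e x) \<noteq> signed_src \<Lambda> (e y)" if "i < x" "x < y" "y \<le> j" for x y
  proof
    assume eq: "signed_src \<Lambda> (e x) = signed_src \<Lambda> (e y)"
    show False
    proof (cases "y = j")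
      case True
      \<comment> \<open>then \<open>x\<close> itself would be an earlier revisit of the source of \<open>e\<^sub>i\<close>\<close>
      with eq that i have "revisit x"
        unfolding revisit_def by auto
      with min that show False by simp
    next
      case False
      with eq that have "y < j" "revisit y"
        unfolding revisit_def by auto
      with min show False by simp
    qed
  qed
  then have "inj_on (\<lambda>n. signed_src \<Lambda> (e n)) {Suc i..<Suc j}"
    by (intro linorder_inj_onI) auto
  then have "distinct (map (signed_src \<Lambda>) p)"
    by (simp add: p_def distinct_map comp_def del: upt_Suc)
  ultimately show ?thesis
    unfolding simple_closed_path_def closed_path_def using walk by blast
qed

lemma trail_Cons: "trail ((f, m) # p) = frag_cmul m (frag_of f) + trail p"
  by (simp add: trail_def)

lemma keys_trail_subset: "Poly_Mapping.keys (trail p) \<subseteq> fst ` set p"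
proof (induction p)
  case Nil
  then show ?case by (simp add: trail_def)
next
  case (Cons e p)
  obtain f m where "e = (f, m)" by (cases e)
  with Cons show ?case
    using keys_add[of "frag_cmul m (frag_of f)" "trail p"] keys_cmul[of m "frag_of f"]
    by (auto simp: trail_Cons)
qed

lemma lookup_trail:
  assumes "distinct (map fst p)" and "(f, m) \<in> set p"
  shows "Poly_Mapping.lookup (trail p) f = m"
  using assms
proof (induction p)
  case Nil
  then show ?case by simp
next
  case (Cons e p)
  obtain g l where e: "e = (g, l)" by (cases e)
  show ?case
  proof (cases "g = f")
    case True
    with Cons.prems e have "m = l" "f \<notin> fst ` set p"
      by (auto simp: image_iff)
    then have "Poly_Mapping.lookup (trail p) f = 0"
      using keys_trail_subset[of p] by (auto simp: in_keys_iff)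
    with True \<open>m = l\<close> e show ?thesis
      by (simp add: trail_Cons lookup_add)
  next
    case False
    with Cons e show ?thesis
      by (simp add: trail_Cons lookup_add)
  qed
qed

text \<open>
  The boundary of a path telescopes to the difference of its endpoints.
\<close>

lemma boundary1_trail:
  assumes "undirected_path k \<Lambda> p"
  shows "boundary1 \<Lambda> (trail p) = frag_of (path_src \<Lambda> p) - frag_of (path_rng \<Lambda> p)"
  using assms
proof (induction p)
  case Nil
  then show ?case by (simp add: undirected_path_def)
next
  case (Cons e p)
  obtain f m where e: "e = (f, m)" by (cases e)
  have m: "m = 1 \<or> m = -1"
    using Cons.prems e by (auto simp: undirected_path_def)
  have edge: "boundary1 \<Lambda> (frag_cmul m (frag_of f)) =
      frag_of (signed_src \<Lambda> e) - frag_of (signed_rng \<Lambda> e)"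
    using m by (auto simp: e boundary1_def frag_extend_cmul frag_extend_minus
        signed_src_def signed_rng_def)
  have sum: "boundary1 \<Lambda> (trail (e # p)) =
      boundary1 \<Lambda> (frag_cmul m (frag_of f)) + boundary1 \<Lambda> (trail p)"
    by (simp add: e trail_Cons boundary1_def frag_extend_add)
  show ?case
  proof (cases "p = []")
    case True
    then show ?thesis
      using sum edge by (simp add: trail_def boundary1_def path_src_def path_rng_def)
  next
    case False
    have "signed_src \<Lambda> e = signed_rng \<Lambda> (hd p)"
      using Cons.prems False by (auto simp: undirected_path_def hd_conv_nth)
    moreover have "undirected_path k \<Lambda> p"
      using Cons.prems False unfolding undirected_path_def by fastforce
    ultimately show ?thesis
      using Cons.IH sum edge False by (simp add: path_src_def path_rng_def)
  qed
qed

text \<open>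
  The trail of a simple closed path along positive edges meets the support of the cycle only, and
  has coefficient \<open>\<plusminus>1\<close> at each edge of the path; hence one multiple of it removes an edge from the
  support without adding any.
\<close>

lemma cycle_support_reduction:
  assumes "boundary1 \<Lambda> a = 0" and "Poly_Mapping.keys a \<subseteq> edges k \<Lambda>" and "a \<noteq> 0"
  shows "\<exists>h c. simple_closed_trail k \<Lambda> h \<and> boundary1 \<Lambda> (a - frag_cmul c h) = 0 \<and>
           Poly_Mapping.keys (a - frag_cmul c h) \<subset> Poly_Mapping.keys a"
proof -
  have "positive_edges a \<subseteq> edges k \<Lambda> \<times> {1, -1}"
    using assms(2) by (auto simp: positive_edges_def sgn_if in_keys_iff)
  moreover have "finite (positive_edges a)" "positive_edges a \<noteq> {}"
    using assms(3) by (simp_all add: positive_edges_def)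
  ultimately obtain p where p: "simple_closed_path k \<Lambda> p" "set p \<subseteq> positive_edges a"
    using successors_give_simple_closed_path[of "positive_edges a"]
      positive_edge_continues[OF assms(1)] by metis
  then have closed: "undirected_path k \<Lambda> p" "path_rng \<Lambda> p = path_src \<Lambda> p" and "distinct p"
    by (auto simp: simple_closed_path_def closed_path_def distinct_map)
  have "inj_on fst (positive_edges a)"
    by (auto simp: positive_edges_def inj_on_def)
  then have dist: "distinct (map fst p)"
    using \<open>distinct p\<close> p(2) by (auto simp: distinct_map intro: inj_on_subset)
  have "p \<noteq> []"
    using closed(1) by (simp add: undirected_path_def)
  then obtain f m where fm: "(f, m) \<in> set p"
    by (metis list.set_intros(1) neq_Nil_conv surj_pair)
  then have f: "f \<in> Poly_Mapping.keys a" "m * m = 1"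
    using p(2) by (auto simp: positive_edges_def sgn_if in_keys_iff)
  define b where "b = a - frag_cmul (Poly_Mapping.lookup a f * m) (trail p)"
  have "Poly_Mapping.keys (trail p) \<subseteq> Poly_Mapping.keys a"
    using keys_trail_subset[of p] p(2) unfolding positive_edges_def by fastforce
  then have "Poly_Mapping.keys b \<subseteq> Poly_Mapping.keys a"
    by (auto simp: b_def in_keys_iff lookup_minus subset_iff)
  moreover have "Poly_Mapping.lookup b f = 0"
    using lookup_trail[OF dist fm] f(2) by (simp add: b_def lookup_minus mult.assoc)
  ultimately have "Poly_Mapping.keys b \<subset> Poly_Mapping.keys a"
    using f(1) by (auto simp: in_keys_iff)
  moreover have "boundary1 \<Lambda> b = 0"
    using assms(1) boundary1_trail[OF closed(1)] closed(2)
    by (simp add: b_def boundary1_def frag_extend_diff frag_extend_cmul)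
  moreover have "simple_closed_trail k \<Lambda> (trail p)"
    using p(1) by (auto simp: simple_closed_trail_def)
  ultimately show ?thesis
    unfolding b_def by blast
qed

lemma cycle_is_combination_of_simple_closed_trails:
  assumes "boundary1 \<Lambda> a = 0" and "Poly_Mapping.keys a \<subseteq> edges k \<Lambda>"
  shows "\<exists>(n::nat) h m. (\<forall>i\<in>{1..n}. simple_closed_trail k \<Lambda> (h i)) \<and>
           a = (\<Sum>i=1..n. frag_cmul (m i) (h i))"
  using assms
proof (induction "card (Poly_Mapping.keys a)" arbitrary: a rule: less_induct)
  case less
  show ?case
  proof (cases "a = 0")
    case True
    then show ?thesis by (intro exI[of _ 0]) auto
  next
    case False
    then obtain g c where g: "simple_closed_trail k \<Lambda> g"
      and b: "boundary1 \<Lambda> (a - frag_cmul c g) = 0"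
        "Poly_Mapping.keys (a - frag_cmul c g) \<subset> Poly_Mapping.keys a"
      using cycle_support_reduction less.prems by blast
    have "card (Poly_Mapping.keys (a - frag_cmul c g)) < card (Poly_Mapping.keys a)"
      using b(2) by (simp add: psubset_card_mono)
    then obtain n h m where h: "\<forall>i\<in>{1..n::nat}. simple_closed_trail k \<Lambda> (h i)"
      and sum: "a - frag_cmul c g = (\<Sum>i=1..n. frag_cmul (m i) (h i))"
      using less.hyps b less.prems(2) by (metis psubset_imp_subset subset_trans)
    let ?h = "h(Suc n := g)" and ?m = "m(Suc n := c)"
    have "(\<Sum>i=1..n. frag_cmul (?m i) (?h i)) = a - frag_cmul c g"
      unfolding sum by (rule sum.cong) auto
    then have "a = (\<Sum>i=1..Suc n. frag_cmul (?m i) (?h i))"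
      by simp
    moreover have "\<forall>i\<in>{1..Suc n}. simple_closed_trail k \<Lambda> (?h i)"
      using h g by auto
    ultimately show ?thesis by blast
  qed
qed

theorem proposition3p15:
  fixes k :: nat and \<Lambda> :: "'a graded_category" and a :: "'a \<Rightarrow>\<^sub>0 int"
  assumes "k_graph k \<Lambda>"
    and "a \<in> kernel (C1 k \<Lambda>) (C0 \<Lambda>) (boundary1 \<Lambda>)"
  shows "\<exists>(n::nat) (h :: nat \<Rightarrow> ('a \<Rightarrow>\<^sub>0 int)) (m :: nat \<Rightarrow> int).
           (\<forall>i\<in>{1..n}. simple_closed_trail k \<Lambda> (h i)) \<and>
           a = (\<Sum>i=1..n. frag_cmul (m i) (h i))"
proof (rule cycle_is_combination_of_simple_closed_trails)
  show "boundary1 \<Lambda> a = 0" "Poly_Mapping.keys a \<subseteq> edges k \<Lambda>"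
    using assms(2) by (simp_all add: kernel_def C0_def C1_def carrier_free_Abelian_group_iff)
qed

end
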